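(* Let $\mathbb{F}$ be a field and $n$ a positive integer. Let $u=(U_k,u_k)_{k\in\mathbb{Z}/n}$ be a locally nilpotent linear representation of the cyclic quiver $\mathcal{C}_n$ over $\mathbb{F}$ with countable dimension. Then $u$ has an adapted basis, i.e. there is a family $(\mathbf{B}_k)_{k\in\mathbb{Z}/n}$ in which, for all $k\in\mathbb{Z}/n$, $\mathbf{B}_k$ is a basis of the vector space $U_k$ and $u_k$ maps every vector in $\mathbf{B}_k$ to a vector in $\mathbf{B}_{k+1}$ or to the zero vector of $U_{k+1}$.
   Context: A linear representation of $\mathcal{C}_n$ (an $n$-cycle of linear mappings) is a family $u=(U_k,u_k)_{k\in\mathbb{Z}/n}$ where each $U_k$ is an $\mathbb{F}$-vector space and $u_k:U_k\to U_{k+1}$ is linear. Its dimension is $\sum_k \dim U_k$; "countable" means of cardinality at most $\aleph_0$. Put $(\pi u)_k:=u_{k+n-1}\circ\cdots\circ u_{k+1}\circ u_k$, an endomorphism of $U_k$. The representation $u$ is locally nilpotent if for every $x\in U_0$ there is an integer $i\ge 0$ with $((\pi u)_0)^i(x)=0$ (equivalently, the same holds for every $k$ in place of $0$). A basis of a vector space is understood as a subset of it (not an indexed family). *)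

theory Defs
  imports "Jordan_Normal_Form.Missing_VectorSpace" "HOL-Library.Countable_Set"
begin

text \<open>
  The index set \<open>\<int>/n\<close> is represented by the residues \<open>{..<n}\<close> with successor
  \<open>k \<mapsto> (k + 1) mod n\<close>. The spaces \<open>U k\<close> are arbitrary vector spaces over the field \<open>K\<close>, each
  with its own carrier and operations; a common type of vectors loses no generality, since the
  carriers are sets of that type and need not be related to each other. Values of \<open>U\<close> and \<open>u\<close> at
  indices \<open>\<ge> n\<close>, and of \<open>u k\<close> outside the carrier of \<open>U k\<close>, are irrelevant.
\<close>

definition cyclic_rep ::
  "('f, 'c) ring_scheme \<Rightarrow> nat \<Rightarrow> (nat \<Rightarrow> ('f, 'v, 'd) module_scheme) \<Rightarrow> (nat \<Rightarrow> 'v \<Rightarrow> 'v) \<Rightarrow> bool"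
  where "cyclic_rep K n U u \<longleftrightarrow>
    (\<forall>k<n. vectorspace K (U k)) \<and>
    (\<forall>k<n. linear_map K (U k) (U ((k + 1) mod n)) (u k))"

text \<open>\<open>path_map n u k j\<close> is \<open>u\<^bsub>k+j-1\<^esub> \<circ> \<dots> \<circ> u\<^bsub>k+1\<^esub> \<circ> u\<^bsub>k\<^esub>\<close>, indices taken modulo \<open>n\<close>.\<close>

primrec path_map :: "nat \<Rightarrow> (nat \<Rightarrow> 'v \<Rightarrow> 'v) \<Rightarrow> nat \<Rightarrow> nat \<Rightarrow> 'v \<Rightarrow> 'v"
  where
    "path_map n u k 0 = id"
  | "path_map n u k (Suc j) = u ((k + j) mod n) \<circ> path_map n u k j"

definition cycle_map :: "nat \<Rightarrow> (nat \<Rightarrow> 'v \<Rightarrow> 'v) \<Rightarrow> nat \<Rightarrow> 'v \<Rightarrow> 'v"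
  where "cycle_map n u k = path_map n u k n"

definition locally_nilpotent ::
  "nat \<Rightarrow> (nat \<Rightarrow> ('f, 'v, 'd) module_scheme) \<Rightarrow> (nat \<Rightarrow> 'v \<Rightarrow> 'v) \<Rightarrow> bool"
  where "locally_nilpotent n U u \<longleftrightarrow>
    (\<forall>x\<in>carrier (U 0). \<exists>i::nat. (cycle_map n u 0 ^^ i) x = \<zero>\<^bsub>U 0\<^esub>)"

text \<open>
  The dimension \<open>\<Sum>\<^sub>k dim U\<^sub>k\<close> is a cardinal, namely that of the disjoint union of bases of the
  \<open>U k\<close>. The constant \<^const>\<open>vectorspace.dim\<close> is not used because it is a natural number, and
  meaningful in finite dimension only.
\<close>

definition countable_dimension ::
  "('f, 'c) ring_scheme \<Rightarrow> nat \<Rightarrow> (nat \<Rightarrow> ('f, 'v, 'd) module_scheme) \<Rightarrow> bool"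
  where "countable_dimension K n U \<longleftrightarrow>
    (\<exists>B. (\<forall>k<n. vectorspace.basis K (U k) (B k)) \<and> countable (SIGMA k:{..<n}. B k))"

definition adapted_basis ::
  "('f, 'c) ring_scheme \<Rightarrow> nat \<Rightarrow> (nat \<Rightarrow> ('f, 'v, 'd) module_scheme) \<Rightarrow> (nat \<Rightarrow> 'v \<Rightarrow> 'v)
    \<Rightarrow> (nat \<Rightarrow> 'v set) \<Rightarrow> bool"
  where "adapted_basis K n U u B \<longleftrightarrow>
    (\<forall>k<n. vectorspace.basis K (U k) (B k) \<and>
      (\<forall>x\<in>B k. u k x \<in> B ((k + 1) mod n) \<or> u k x = \<zero>\<^bsub>U ((k + 1) mod n)\<^esub>))"

end

theory Submission
  imports Defs
begin

text \<open>
  Refine the image filtration transfinitely: starting from the whole representation, take images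
  under the structure maps and intersections. This yields a chain of subrepresentations that
  measures the height of each homogeneous vector. A finite independent homogeneous set \<open>B\<close>, mapped
  by the structure maps into itself or to zero, is called admissible if the span of \<open>B\<close> meets every
  member \<open>F\<close> of the chain in the span of \<open>B \<inter> F\<close>. The point is that admissible sets can be enlarged
  without ever changing the vectors already chosen, so that in countable dimension the union of an
  increasing sequence of them is an adapted basis.

  To absorb a vector \<open>v\<close> whose image \<open>u v\<close> is spanned by \<open>B\<close>, translate \<open>v\<close> to maximal height, with
  level \<open>F\<close>. Then \<open>u v\<close> is a combination of vectors of \<open>B\<close> having preimages in \<open>F\<close>. If each of them
  has a preimage in \<open>B \<inter> F\<close>, or one of strictly larger height than \<open>v\<close>, adjoin preimages; the
  remaining difference is killed by \<open>u\<close>, and it is still of maximal height modulo the span.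
  Otherwise fix one \<open>q\<close> that has neither, adjoin preimages of the others, and correct \<open>v\<close> by them to
  a preimage of \<open>q\<close>; this one can be adjoined. Local nilpotency is the induction reducing to the
  case where \<open>u v\<close> is already spanned.
\<close>

subsection \<open>Linear algebra\<close>

lemma (in abelian_group) add_minus_cancel:
  assumes "x \<in> carrier G" "y \<in> carrier G"
  shows "(x \<oplus> y) \<ominus> y = x" and "(x \<oplus> y) \<ominus> x = y"
proof -
  have *: "(a \<oplus> b) \<ominus> b = a" if "a \<in> carrier G" "b \<in> carrier G" for a b
    using that by (simp add: a_minus_def a_assoc r_neg)
  show "(x \<oplus> y) \<ominus> y = x" using * assms by blast
  show "(x \<oplus> y) \<ominus> x = y" using *[of y x] assms by (simp add: a_comm)
qed

lemma (in module) submodule_minus: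
  assumes "submodule R N M" "x \<in> N" "y \<in> N"
  shows "x \<ominus>\<^bsub>M\<^esub> y \<in> N"
proof -
  interpret submodule R N M by fact
  have "y \<in> carrier M" using assms subset by blast
  then have "\<ominus>\<^bsub>M\<^esub> y = (\<ominus>\<^bsub>R\<^esub> \<one>\<^bsub>R\<^esub>) \<odot>\<^bsub>M\<^esub> y"
    by (simp add: smult_minus_1)
  then show ?thesis using assms by (simp add: a_minus_def)
qed

text \<open>The vectors of this form make up a submodule that contains \<open>insert y A\<close>, so
  the span lies inside it.\<close>

lemma (in module) span_insertE:
  assumes "A \<subseteq> carrier M" "y \<in> carrier M" "z \<in> span (insert y A)"
  obtains c w where "c \<in> carrier R" "w \<in> span A" "z = c \<odot>\<^bsub>M\<^esub> y \<oplus>\<^bsub>M\<^esub> w"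
proof -
  let ?N = "{c \<odot>\<^bsub>M\<^esub> y \<oplus>\<^bsub>M\<^esub> w | c w. c \<in> carrier R \<and> w \<in> span A}"
  interpret S: submodule R "span A" M using span_is_submodule assms by blast
  have sc: "w \<in> carrier M" if "w \<in> span A" for w using that S.subset by blast
  have "submodule R ?N M"
  proof
    show "?N \<subseteq> carrier M" using assms(2) sc by auto
    show "\<zero>\<^bsub>M\<^esub> \<in> ?N"
      using assms(2) by (auto intro!: exI[of _ "\<zero>\<^bsub>R\<^esub>"] exI[of _ "\<zero>\<^bsub>M\<^esub>"])
  next
    fix v w assume "v \<in> ?N" "w \<in> ?N"
    then obtain c a d b where v: "c \<in> carrier R" "a \<in> span A" "v = c \<odot>\<^bsub>M\<^esub> y \<oplus>\<^bsub>M\<^esub> a"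
      and w: "d \<in> carrier R" "b \<in> span A" "w = d \<odot>\<^bsub>M\<^esub> y \<oplus>\<^bsub>M\<^esub> b" by blast
    have "v \<oplus>\<^bsub>M\<^esub> w = (c \<oplus>\<^bsub>R\<^esub> d) \<odot>\<^bsub>M\<^esub> y \<oplus>\<^bsub>M\<^esub> (a \<oplus>\<^bsub>M\<^esub> b)"
      using v w assms(2) sc by (simp add: smult_l_distr M.a_ac)
    then show "v \<oplus>\<^bsub>M\<^esub> w \<in> ?N" using v w by blast
  next
    fix d v assume "d \<in> carrier R" "v \<in> ?N"
    then obtain c a where v: "c \<in> carrier R" "a \<in> span A" "v = c \<odot>\<^bsub>M\<^esub> y \<oplus>\<^bsub>M\<^esub> a"
      by blast
    have "d \<odot>\<^bsub>M\<^esub> v = (d \<otimes>\<^bsub>R\<^esub> c) \<odot>\<^bsub>M\<^esub> y \<oplus>\<^bsub>M\<^esub> (d \<odot>\<^bsub>M\<^esub> a)"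
      using v \<open>d \<in> _\<close> assms(2) sc by (simp add: smult_r_distr smult_assoc1)
    then show "d \<odot>\<^bsub>M\<^esub> v \<in> ?N" using v \<open>d \<in> _\<close> by blast
  qed
  moreover have "insert y A \<subseteq> ?N"
  proof -
    have "y = \<one>\<^bsub>R\<^esub> \<odot>\<^bsub>M\<^esub> y \<oplus>\<^bsub>M\<^esub> \<zero>\<^bsub>M\<^esub>" using assms by simp
    then have "y \<in> ?N" using S.zero_closed R.one_closed by blast
    moreover have "a \<in> ?N" if "a \<in> A" for a
    proof -
      have "a \<in> span A" using that in_own_span assms by blast
      moreover have "a = \<zero>\<^bsub>R\<^esub> \<odot>\<^bsub>M\<^esub> y \<oplus>\<^bsub>M\<^esub> a" using that assms by auto
      ultimately show ?thesis using R.zero_closed by blast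
    qed
    ultimately show ?thesis by blast
  qed
  ultimately have "z \<in> ?N" using span_is_subset assms(3) by blast
  then show ?thesis using that by blast
qed

text \<open>A dependence relation involves finitely many vectors, and these already lie in one
  member of the chain.\<close>

lemma (in module) lin_indpt_Union_chain:
  assumes "subset.chain UNIV \<A>" "\<A> \<noteq> {}" "\<And>A. A \<in> \<A> \<Longrightarrow> lin_indpt A"
  shows "lin_indpt (\<Union>\<A>)"
proof
  assume "lin_dep (\<Union>\<A>)"
  then obtain A a v where A: "finite A" "A \<subseteq> \<Union>\<A>" "a \<in> A \<rightarrow> carrier R"
    "lincomb a A = \<zero>\<^bsub>M\<^esub>" "v \<in> A" "a v \<noteq> \<zero>\<^bsub>R\<^esub>"
    unfolding lin_dep_def by blast
  obtain S where "S \<in> \<A>" "A \<subseteq> S"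
    using finite_subset_Union_chain[OF A(1,2) assms(2,1)] by blast
  then have "lin_dep S" unfolding lin_dep_def using A by blast
  then show False using assms(3) \<open>S \<in> \<A>\<close> by blast
qed

lemma (in vectorspace) lin_indpt_insert:
  assumes "S \<subseteq> carrier V" "lin_indpt S" "v \<in> carrier V" "v \<notin> span S"
  shows "lin_indpt (insert v S)"
proof -
  have "v \<notin> S" using assms in_own_span by blast
  then show ?thesis using lin_dep_iff_in_span[OF assms(1-3)] assms(4) by simp
qed

lemma (in vectorspace) lin_indpt_not_in_span:
  assumes "S \<subseteq> carrier V" "lin_indpt S" "v \<in> S"
  shows "v \<notin> span (S - {v})"
proof -
  have "S - {v} \<subseteq> carrier V" "v \<in> carrier V" "lin_indpt (S - {v})"
    using assms subset_li_is_li[of S "S - {v}"] by auto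
  from lin_dep_iff_in_span[OF this(1,3,2)] show ?thesis
    using assms by (simp add: insert_absorb)
qed

lemma (in vectorspace) smult_inv_cancel:
  assumes "c \<in> carrier K" "c \<noteq> \<zero>\<^bsub>K\<^esub>" "v \<in> carrier V"
  shows "c \<odot>\<^bsub>V\<^esub> (inv\<^bsub>K\<^esub> c \<odot>\<^bsub>V\<^esub> v) = v"
proof -
  have "c \<in> Units K" using assms by (simp add: field.field_Units)
  then have "c \<otimes>\<^bsub>K\<^esub> inv\<^bsub>K\<^esub> c = \<one>\<^bsub>K\<^esub>" "inv\<^bsub>K\<^esub> c \<in> carrier K" by auto
  then show ?thesis using assms by (simp add: smult_assoc1[symmetric])
qed

section \<open>Submodules under linear maps\<close>

lemma (in linear_map) submodule_vimage:
  assumes "submodule K N W"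
  shows "submodule K {x \<in> carrier V. T x \<in> N} V"
proof -
  interpret N: submodule K N W by fact
  show ?thesis by standard auto
qed

lemma (in linear_map) submodule_image:
  assumes "submodule K N V"
  shows "submodule K (T ` N) W"
proof -
  interpret N: submodule K N V by fact
  have c: "x \<in> N \<Longrightarrow> x \<in> carrier V" for x using N.subset by blast
  show ?thesis
  proof
    show "T ` N \<subseteq> carrier W" using c by auto
    show "\<zero>\<^bsub>W\<^esub> \<in> T ` N" using N.zero_closed T0_is_0 by (metis imageI)
    fix v w assume "v \<in> T ` N" "w \<in> T ` N"
    then obtain x y where "x \<in> N" "y \<in> N" "v = T x" "w = T y" by blast
    then have "v \<oplus>\<^bsub>W\<^esub> w = T (x \<oplus>\<^bsub>V\<^esub> y)" using c by simp
    then show "v \<oplus>\<^bsub>W\<^esub> w \<in> T ` N" using \<open>x \<in> N\<close> \<open>y \<in> N\<close> by blast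
  next
    fix a v assume "a \<in> carrier K" "v \<in> T ` N"
    then obtain x where "x \<in> N" "v = T x" by blast
    then have "a \<odot>\<^bsub>W\<^esub> v = T (a \<odot>\<^bsub>V\<^esub> x)" using c \<open>a \<in> _\<close> by simp
    then show "a \<odot>\<^bsub>W\<^esub> v \<in> T ` N" using \<open>x \<in> N\<close> \<open>a \<in> _\<close> by blast
  qed
qed

subsection \<open>Graded subspaces\<close>

text \<open>A whole type serves as index set, which avoids membership side conditions. Bijectivity
  of \<open>\<sigma>\<close> gives every vertex exactly one incoming arrow, so images of graded
  subspaces are again graded subspaces.\<close>

locale graded_rep =
  fixes K :: "('f, 'c) ring_scheme"
    and U :: "'i \<Rightarrow> ('f, 'v, 'd) module_scheme"
    and \<sigma> :: "'i \<Rightarrow> 'i"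
    and u :: "'i \<Rightarrow> 'v \<Rightarrow> 'v"
  assumes linear: "linear_map K (U k) (U (\<sigma> k)) (u k)"
    and bij: "bij \<sigma>"
begin

sublocale L: linear_map K "U k" "U (\<sigma> k)" "u k" for k
  by (rule linear)

text \<open>Homogeneous vectors carry their index because the carriers may overlap. A set of such
  pairs encodes a family of subsets, and inclusion and intersection act slice by slice.\<close>

definition vectors :: "('i \<times> 'v) set"
  where "vectors = (SIGMA k:UNIV. carrier (U k))"

definition shift :: "'i \<times> 'v \<Rightarrow> 'i \<times> 'v"
  where "shift = (\<lambda>(k, x). (\<sigma> k, u k x))"

definition zeros :: "('i \<times> 'v) set"
  where "zeros = (SIGMA k:UNIV. {\<zero>\<^bsub>U k\<^esub>})"

definition gsubspace :: "('i \<times> 'v) set \<Rightarrow> bool"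
  where "gsubspace F \<longleftrightarrow> (\<forall>k. submodule K (F `` {k}) (U k))"

definition gspan :: "('i \<times> 'v) set \<Rightarrow> ('i \<times> 'v) set"
  where "gspan B = (SIGMA k:UNIV. module.span K (U k) (B `` {k}))"

definition gindpt :: "('i \<times> 'v) set \<Rightarrow> bool"
  where "gindpt B \<longleftrightarrow> (\<forall>k. module.lin_indpt K (U k) (B `` {k}))"

lemma shift_simp [simp]: "shift (k, x) = (\<sigma> k, u k x)"
  by (simp add: shift_def)

lemma vectors_iff [simp]: "(k, x) \<in> vectors \<longleftrightarrow> x \<in> carrier (U k)"
  by (simp add: vectors_def)

lemma zeros_iff [simp]: "(k, x) \<in> zeros \<longleftrightarrow> x = \<zero>\<^bsub>U k\<^esub>"
  by (simp add: zeros_def)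

lemma \<sigma>_eq_iff [simp]: "\<sigma> j = \<sigma> k \<longleftrightarrow> j = k"
  using bij by (simp add: bij_is_inj inj_eq)

lemma shift_vectors: "p \<in> vectors \<Longrightarrow> shift p \<in> vectors"
  by (cases p) simp

lemma slice_vectors: "B \<subseteq> vectors \<Longrightarrow> B `` {k} \<subseteq> carrier (U k)"
  by auto

section \<open>Closure properties of graded subspaces\<close>

lemma gsubspace_subset: "gsubspace F \<Longrightarrow> F \<subseteq> vectors"
  unfolding gsubspace_def submodule_def by (fastforce simp: subset_iff)

lemma gsubspace_carrier: "gsubspace F \<Longrightarrow> (k, x) \<in> F \<Longrightarrow> x \<in> carrier (U k)"
  using gsubspace_subset by fastforce

lemma gsubspace_zero: "gsubspace F \<Longrightarrow> (k, \<zero>\<^bsub>U k\<^esub>) \<in> F"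
  unfolding gsubspace_def submodule_def by blast

lemma gsubspace_add:
  "gsubspace F \<Longrightarrow> (k, x) \<in> F \<Longrightarrow> (k, y) \<in> F \<Longrightarrow> (k, x \<oplus>\<^bsub>U k\<^esub> y) \<in> F"
  unfolding gsubspace_def submodule_def by blast

lemma gsubspace_smult:
  "gsubspace F \<Longrightarrow> c \<in> carrier K \<Longrightarrow> (k, x) \<in> F \<Longrightarrow> (k, c \<odot>\<^bsub>U k\<^esub> x) \<in> F"
  unfolding gsubspace_def submodule_def by blast

lemma gsubspace_minus:
  assumes "gsubspace F" "(k, x) \<in> F" "(k, y) \<in> F"
  shows "(k, x \<ominus>\<^bsub>U k\<^esub> y) \<in> F"
  using L.submodule_minus[of "F `` {k}" k x y] assms unfolding gsubspace_def by blast

lemma gsubspace_vectors: "gsubspace vectors"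
proof -
  have "vectors `` {k} = carrier (U k)" for k by auto
  moreover have "submodule K (carrier (U k)) (U k)" for k
    by standard auto
  ultimately show ?thesis by (simp add: gsubspace_def)
qed

lemma gsubspace_shift:
  assumes "gsubspace F"
  shows "gsubspace (shift ` F)"
  unfolding gsubspace_def
proof
  fix j
  \<comment> \<open>Surjectivity of \<open>\<sigma>\<close> supplies the predecessor; injectivity
    makes it the only index contributing to the slice at \<open>j\<close>.\<close>
  obtain k where j: "j = \<sigma> k" using bij by (meson bij_pointE)
  have "(shift ` F) `` {\<sigma> k} = u k ` (F `` {k})" by (force simp: shift_def image_iff)
  then show "submodule K ((shift ` F) `` {j}) (U j)"
    using L.submodule_image assms unfolding j gsubspace_def by simp
qed

lemma gsubspace_vimage:
  assumes "gsubspace F"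
  shows "gsubspace {p \<in> vectors. shift p \<in> F}"
  unfolding gsubspace_def
proof
  fix k
  have "{p \<in> vectors. shift p \<in> F} `` {k} = {x \<in> carrier (U k). u k x \<in> F `` {\<sigma> k}}"
    by auto
  then show "submodule K ({p \<in> vectors. shift p \<in> F} `` {k}) (U k)"
    using L.submodule_vimage[of "F `` {\<sigma> k}" k] assms unfolding gsubspace_def by metis
qed

lemma gsubspace_Inter:
  assumes "\<And>F. F \<in> \<M> \<Longrightarrow> gsubspace F" "\<M> \<noteq> {}"
  shows "gsubspace (\<Inter>\<M>)"
  unfolding gsubspace_def
proof
  fix k
  obtain F where "F \<in> \<M>" using assms by blast
  then have "\<Inter>\<M> \<subseteq> vectors" using gsubspace_subset assms by blast
  then show "submodule K ((\<Inter>\<M>) `` {k}) (U k)"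
    using assms gsubspace_zero gsubspace_add gsubspace_smult
    by unfold_locales auto
qed

section \<open>Graded spans and independence\<close>

lemma gspan_iff: "(k, x) \<in> gspan B \<longleftrightarrow> x \<in> module.span K (U k) (B `` {k})"
  by (simp add: gspan_def)

lemma gsubspace_gspan: "B \<subseteq> vectors \<Longrightarrow> gsubspace (gspan B)"
  unfolding gsubspace_def gspan_def
  using L.span_is_submodule[OF slice_vectors] by (simp add: Image_def)

lemma subset_gspan: "B \<subseteq> vectors \<Longrightarrow> B \<subseteq> gspan B"
  using subsetD[OF L.in_own_span[OF slice_vectors]] by (auto simp: gspan_def)

lemma gspan_mono: "A \<subseteq> B \<Longrightarrow> gspan A \<subseteq> gspan B"
  unfolding gspan_def by (intro Sigma_mono L.span_is_monotone Image_mono order_refl)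

lemma gspan_subset: "B \<subseteq> F \<Longrightarrow> gsubspace F \<Longrightarrow> gspan B \<subseteq> F"
  unfolding gspan_def gsubspace_def
  using L.span_is_subset[OF Image_mono[OF _ order_refl]] by blast

lemma gspan_insertE:
  assumes "B \<subseteq> vectors" "y \<in> carrier (U k)" "(k, z) \<in> gspan (insert (k, y) B)"
  obtains c w where "c \<in> carrier K" "(k, w) \<in> gspan B" "z = c \<odot>\<^bsub>U k\<^esub> y \<oplus>\<^bsub>U k\<^esub> w"
proof -
  have "insert (k, y) B `` {k} = insert y (B `` {k})" by auto
  then show ?thesis
    using L.span_insertE[of "B `` {k}" k y z] slice_vectors[OF assms(1)] assms that
    by (metis gspan_iff)
qed

lemma gspan_insert_other: "j \<noteq> k \<Longrightarrow> (j, z) \<in> gspan (insert (k, y) B) \<longleftrightarrow> (j, z) \<in> gspan B"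
proof -
  assume "j \<noteq> k"
  then have "insert (k, y) B `` {j} = B `` {j}" by auto
  then show ?thesis by (simp add: gspan_iff)
qed

lemma gspan_UnE:
  assumes "A \<subseteq> vectors" "B \<subseteq> vectors" "(k, z) \<in> gspan (A \<union> B)"
  obtains a b where "(k, a) \<in> gspan A" "(k, b) \<in> gspan B" "z = a \<oplus>\<^bsub>U k\<^esub> b"
proof -
  let ?A = "A `` {k}" and ?B = "B `` {k}"
  have *: "z \<in> module.span K (U k) (?A \<union> ?B)"
    using assms(3) by (simp add: gspan_iff Un_Image)
  have A: "subspace K (module.span K (U k) ?A) (U k)" and B: "subspace K (module.span K (U k) ?B) (U k)"
    using L.span_is_subspace slice_vectors assms by blast+
  let ?S = "module.submodule_sum (U k) (module.span K (U k) ?A) (module.span K (U k) ?B)"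
  have "submodule K ?S (U k)"
    using L.sum_is_subspace[OF A B] L.is_module by blast
  moreover have "?A \<union> ?B \<subseteq> ?S"
    using L.in_sum_vs[OF A B] L.in_sum_vs[OF B A] L.vsum_comm[OF A B]
      L.in_own_span[OF slice_vectors[OF assms(1)]] L.in_own_span[OF slice_vectors[OF assms(2)]]
    by blast
  ultimately have "z \<in> ?S" using * L.span_is_subset by blast
  then show ?thesis using that unfolding L.submodule_sum_def by (auto simp: gspan_iff)
qed

text \<open>The image of \<open>gspan A\<close> under \<open>shift\<close> is a graded subspace
  containing the generators, hence their span. Injectivity of \<open>\<sigma>\<close> puts the
  preimage in degree \<open>k\<close>.\<close>

lemma gspan_shiftE:
  assumes "A \<subseteq> vectors" "(\<sigma> k, r) \<in> gspan (shift ` A)"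
  obtains z where "(k, z) \<in> gspan A" "u k z = r"
proof -
  have "gspan (shift ` A) \<subseteq> shift ` gspan A"
    using gspan_subset gsubspace_shift gsubspace_gspan subset_gspan assms by (meson image_mono)
  then obtain p where "p \<in> gspan A" "shift p = (\<sigma> k, r)" using assms by (metis imageE subsetD)
  then show ?thesis using that by (cases p) auto
qed

lemma shift_gspan:
  assumes "A \<subseteq> vectors" "C \<subseteq> vectors" "shift ` A \<subseteq> C \<union> zeros" "p \<in> gspan A"
  shows "shift p \<in> gspan C"
proof -
  have "zeros \<subseteq> gspan C" using gsubspace_zero[OF gsubspace_gspan[OF assms(2)]] by auto
  then have "A \<subseteq> {p \<in> vectors. shift p \<in> gspan C}"
    using assms subset_gspan by blast
  then show ?thesis
    using gspan_subset gsubspace_vimage[OF gsubspace_gspan[OF assms(2)]] assms(4) by blast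
qed

lemma gindpt_insert:
  assumes "B \<subseteq> vectors" "gindpt B" "y \<in> carrier (U k)" "(k, y) \<notin> gspan B"
  shows "gindpt (insert (k, y) B)"
  unfolding gindpt_def
proof
  fix j
  show "module.lin_indpt K (U j) (insert (k, y) B `` {j})"
  proof (cases "j = k")
    case True
    have "insert (k, y) B `` {k} = insert y (B `` {k})" by auto
    then show ?thesis
      using L.lin_indpt_insert[OF slice_vectors[OF assms(1)]] assms True
      by (simp add: gindpt_def gspan_iff)
  next
    case False
    then have "insert (k, y) B `` {j} = B `` {j}" by auto
    then show ?thesis using assms by (simp add: gindpt_def)
  qed
qed

lemma gindpt_not_in_gspan:
  assumes "B \<subseteq> vectors" "gindpt B" "p \<in> B"
  shows "p \<notin> gspan (B - {p})"
proof -
  obtain k y where p: "p = (k, y)" by (cases p)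
  have "(B - {(k, y)}) `` {k} = B `` {k} - {y}" by auto
  then show ?thesis
    using L.lin_indpt_not_in_span[OF slice_vectors[OF assms(1)]] assms p
    by (simp add: gindpt_def gspan_iff)
qed

end

subsection \<open>Heights and admissible sets\<close>

text \<open>The later arguments see the chain only through these closure properties. Intersections
  give each homogeneous vector a smallest member containing it; closure under images lets a
  condition on a preimage be tested on its image.\<close>

locale filtered_rep = graded_rep K U \<sigma> u
  for K :: "('f, 'c) ring_scheme"
    and U :: "'i \<Rightarrow> ('f, 'v, 'd) module_scheme"
    and \<sigma> :: "'i \<Rightarrow> 'i"
    and u :: "'i \<Rightarrow> 'v \<Rightarrow> 'v" +
  fixes \<C> :: "('i \<times> 'v) set set"
  assumes vectors_in: "vectors \<in> \<C>"
    and gsubspace: "F \<in> \<C> \<Longrightarrow> gsubspace F"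
    and total: "F \<in> \<C> \<Longrightarrow> G \<in> \<C> \<Longrightarrow> F \<subseteq> G \<or> G \<subseteq> F"
    and shift_in: "F \<in> \<C> \<Longrightarrow> shift ` F \<in> \<C>"
    and Inter_in: "\<M> \<subseteq> \<C> \<Longrightarrow> \<M> \<noteq> {} \<Longrightarrow> \<Inter>\<M> \<in> \<C>"

text \<open>The image is iterated transfinitely, with intersections at limits. Since iterates in a
  chain-complete order ascend through suprema, the construction runs on complements:
  \<open>f\<close> is the complement of the image of the complement, and unions turn into
  intersections.\<close>

lemma (in graded_rep) filtration_exists: "\<exists>\<C>. filtered_rep K U \<sigma> u \<C>"
proof -
  define f where "f S = - shift ` (vectors - S)" for S
  define \<C> where "\<C> = (\<lambda>S. vectors - S) ` ccpo_class.iterates f"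
  have mono: "monotone (\<le>) (\<le>) f"
    by (rule monotoneI) (auto simp: f_def)
  have step: "shift ` (vectors - S) = vectors - f S" for S
    using shift_vectors by (auto simp: f_def)
  have Inter: "\<Inter>((\<lambda>S. vectors - S) ` M) = vectors - \<Union>M" if "M \<noteq> {}" for M
    using that by blast
  have "gsubspace (vectors - S)" if "S \<in> ccpo_class.iterates f" for S
    using that
  proof (induction rule: ccpo_class.iterates.induct)
    case (step S)
    then show ?case using gsubspace_shift \<open>shift ` (vectors - S) = vectors - f S\<close> by metis
  next
    case (Sup M)
    show ?case
    proof (cases "M = {}")
      \<comment> \<open>The supremum of the empty chain is the start of the iteration; its
        complement is all of \<open>vectors\<close>.\<close>
      case True
      then show ?thesis using gsubspace_vectors by simp
    next
      case False
      then have "gsubspace (\<Inter>((\<lambda>S. vectors - S) ` M))"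
        using Sup by (intro gsubspace_Inter) auto
      then show ?thesis using Inter[OF False] by simp
    qed
  qed
  moreover have "vectors \<in> \<C>"
    unfolding \<C>_def using ccpo_class.bot_in_iterates[of f] by force
  moreover have "F \<subseteq> G \<or> G \<subseteq> F" if "F \<in> \<C>" "G \<in> \<C>" for F G
    using that ccpo_class.chain_iterates[OF mono] unfolding \<C>_def Complete_Partial_Order.chain_def by blast
  moreover have "shift ` F \<in> \<C>" if "F \<in> \<C>" for F
    using that unfolding \<C>_def by (auto simp: step intro!: imageI ccpo_class.iterates.step)
  moreover have "\<Inter>\<M> \<in> \<C>" if "\<M> \<subseteq> \<C>" "\<M> \<noteq> {}" for \<M>
  proof -
    obtain M where M: "M \<subseteq> ccpo_class.iterates f" "\<M> = (\<lambda>S. vectors - S) ` M"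
      using \<open>\<M> \<subseteq> \<C>\<close> unfolding \<C>_def by (meson subset_imageE)
    have "Complete_Partial_Order.chain (\<subseteq>) M"
      using ccpo_class.chain_iterates[OF mono] M(1) by (rule Complete_Partial_Order.chain_subset)
    then have SM: "\<Union>M \<in> ccpo_class.iterates f"
      using M(1) by (intro ccpo_class.iterates.Sup) auto
    have "M \<noteq> {}" using M(2) that(2) by blast
    show ?thesis unfolding \<C>_def M(2) Inter[OF \<open>M \<noteq> {}\<close>] using SM by (rule imageI)
  qed
  ultimately have "filtered_rep K U \<sigma> u \<C>"
    by unfold_locales (auto simp: \<C>_def)
  then show ?thesis by blast
qed

section \<open>Levels, admissible sets and vectors of maximal height\<close>

context filtered_rep
begin

text \<open>The smallest member of the chain containing \<open>p\<close>, when \<open>p\<close> is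
  in \<open>vectors\<close>. A smaller level means a larger height.\<close>

definition level :: "'i \<times> 'v \<Rightarrow> ('i \<times> 'v) set"
  where "level p = \<Inter>{F \<in> \<C>. p \<in> F}"

lemma level_in: "p \<in> vectors \<Longrightarrow> level p \<in> \<C>"
  unfolding level_def using vectors_in by (intro Inter_in) auto

lemma mem_level: "p \<in> level p"
  by (simp add: level_def)

lemma level_subset: "F \<in> \<C> \<Longrightarrow> p \<in> F \<Longrightarrow> level p \<subseteq> F"
  by (auto simp: level_def)

text \<open>Given independence, the last conjunct says that the height of a combination is the least
  height among the vectors occurring in it.\<close>

definition admissible :: "('i \<times> 'v) set \<Rightarrow> bool"
  where "admissible B \<longleftrightarrow> finite B \<and> B \<subseteq> vectors \<and> gindpt B \<and> shift ` B \<subseteq> B \<union> zeros \<and>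
    (\<forall>F\<in>\<C>. gspan B \<inter> F \<subseteq> gspan (B \<inter> F))"

text \<open>In terms of heights: no translate of \<open>y\<close> by \<open>gspan B\<close> is
  higher than \<open>y\<close>.\<close>

definition proper :: "('i \<times> 'v) set \<Rightarrow> 'i \<Rightarrow> 'v \<Rightarrow> bool"
  where "proper B k y \<longleftrightarrow>
    (\<forall>F\<in>\<C>. \<forall>w. (k, w) \<in> gspan B \<longrightarrow> (k, y \<oplus>\<^bsub>U k\<^esub> w) \<in> F \<longrightarrow> (k, y) \<in> F)"

lemma admissible_empty: "admissible {}"
proof -
  have "gspan {} \<subseteq> gspan ({} \<inter> F)" for F by simp
  moreover have "gindpt {}" by (auto simp: gindpt_def L.lin_dep_def)
  ultimately show ?thesis by (auto simp: admissible_def)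
qed

text \<open>If \<open>c y + w\<close> with \<open>c\<close> nonzero lies in \<open>F\<close>,
  dividing by \<open>c\<close> gives a translate of \<open>y\<close> in \<open>F\<close>. Properness
  puts \<open>y\<close> in \<open>F\<close>, hence also \<open>w\<close>, and admissibility of
  \<open>B\<close> expresses \<open>w\<close> through \<open>B \<inter> F\<close>.\<close>

lemma admissible_insert:
  assumes B: "admissible B" and y: "y \<in> carrier (U k)" and new: "(k, y) \<notin> gspan B"
    and sh: "shift (k, y) \<in> B \<union> zeros" and "proper B k y"
  shows "admissible (insert (k, y) B)"
proof -
  let ?B = "insert (k, y) B"
  have BV: "B \<subseteq> vectors" using B by (simp add: admissible_def)
  have "(j, z) \<in> gspan (?B \<inter> F)" if F: "F \<in> \<C>" and z: "(j, z) \<in> gspan ?B" "(j, z) \<in> F" for F j z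
  proof (cases "(j, z) \<in> gspan B")
    case True
    then have "(j, z) \<in> gspan (B \<inter> F)" using B F z by (auto simp: admissible_def)
    then show ?thesis using gspan_mono[of "B \<inter> F" "?B \<inter> F"] by auto
  next
    case False
    then have j: "j = k" using z gspan_insert_other by metis
    obtain c w where c: "c \<in> carrier K" and w: "(k, w) \<in> gspan B"
      and zc: "z = c \<odot>\<^bsub>U k\<^esub> y \<oplus>\<^bsub>U k\<^esub> w"
      using gspan_insertE[OF BV y] z j by metis
    have wc: "w \<in> carrier (U k)" using w gsubspace_carrier[OF gsubspace_gspan[OF BV]] by blast
    have c0: "c \<noteq> \<zero>\<^bsub>K\<^esub>" using False w zc y wc j by auto
    let ?d = "inv\<^bsub>K\<^esub> c"
    have d: "?d \<in> carrier K" using c c0 by blast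
    have "?d \<odot>\<^bsub>U k\<^esub> z = y \<oplus>\<^bsub>U k\<^esub> (?d \<odot>\<^bsub>U k\<^esub> w)"
      using zc c d y wc L.mult_inverse[OF c y refl c0] by (simp add: L.smult_r_distr)
    moreover have "(k, ?d \<odot>\<^bsub>U k\<^esub> z) \<in> F"
      using gsubspace_smult[OF gsubspace[OF F] d] z j by blast
    moreover have "(k, ?d \<odot>\<^bsub>U k\<^esub> w) \<in> gspan B"
      using gsubspace_smult[OF gsubspace_gspan[OF BV] d w] .
    ultimately have yF: "(k, y) \<in> F" using \<open>proper B k y\<close> F unfolding proper_def by metis
    have "z \<ominus>\<^bsub>U k\<^esub> c \<odot>\<^bsub>U k\<^esub> y = w"
      unfolding zc using c y wc by (simp add: L.add_minus_cancel)
    then have "(k, w) \<in> F"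
      using gsubspace_minus[OF gsubspace[OF F], of k z "c \<odot>\<^bsub>U k\<^esub> y"]
        gsubspace_smult[OF gsubspace[OF F] c yF] z j by auto
    then have "(k, w) \<in> gspan (B \<inter> F)" using w F B by (auto simp: admissible_def)
    then have "(k, w) \<in> gspan (?B \<inter> F)" using gspan_mono[of "B \<inter> F" "?B \<inter> F"] by auto
    moreover have sV: "?B \<inter> F \<subseteq> vectors" using BV y by auto
    then have "(k, y) \<in> gspan (?B \<inter> F)" using subset_gspan yF by blast
    ultimately show ?thesis
      unfolding zc j using gsubspace_gspan[OF sV] c gsubspace_add gsubspace_smult by metis
  qed
  then have "\<forall>F\<in>\<C>. gspan ?B \<inter> F \<subseteq> gspan (?B \<inter> F)" by fastforce
  then show ?thesis
    using B gindpt_insert[OF BV _ y new] y sh by (auto simp: admissible_def)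
qed

text \<open>Optimality is claimed only against members \<open>F\<close> that contain some
  \<open>y'\<close> from \<open>S\<close>. In this form it serves both for a coset of
  \<open>gspan B\<close> and for the preimages of a fixed vector, which need not be stable under
  translation.\<close>

lemma optimal_exists:
  assumes B: "admissible B" and S: "S \<noteq> {}" "S \<subseteq> carrier (U k)"
  obtains y where "y \<in> S"
    "\<And>F w y'. \<lbrakk>F \<in> \<C>; (k, w) \<in> gspan B; (k, y \<oplus>\<^bsub>U k\<^esub> w) \<in> F; y' \<in> S; (k, y') \<in> F\<rbrakk> \<Longrightarrow> (k, y) \<in> F"
proof -
  have fin: "finite B" and BV: "B \<subseteq> vectors" using B by (auto simp: admissible_def)
  \<comment> \<open>Heights need not attain a maximum on \<open>S\<close>, but only finitely many sets \<open>B \<inter> level (k, y)\<close> occur,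
    and minimality of that set is enough.\<close>
  obtain y where y: "y \<in> S"
    and min: "\<And>y'. y' \<in> S \<Longrightarrow> card (B \<inter> level (k, y)) \<le> card (B \<inter> level (k, y'))"
    using ex_has_least_nat[of "\<lambda>y. y \<in> S" _ "\<lambda>y. card (B \<inter> level (k, y))"] S(1) by blast
  have yc: "y \<in> carrier (U k)" using y S by blast
  have "(k, y) \<in> F"
    if F: "F \<in> \<C>" and w: "(k, w) \<in> gspan B" and yw: "(k, y \<oplus>\<^bsub>U k\<^esub> w) \<in> F"
      and y': "y' \<in> S" "(k, y') \<in> F" for F w y'
  proof (rule ccontr)
    assume "(k, y) \<notin> F"
    let ?H = "level (k, y)"
    have H: "?H \<in> \<C>" using level_in yc by simp
    then have FH: "F \<subseteq> ?H" using total[OF F H] mem_level \<open>(k, y) \<notin> F\<close> by blast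
    have wc: "w \<in> carrier (U k)" using w gsubspace_carrier[OF gsubspace_gspan[OF BV]] by blast
    have "B \<inter> level (k, y') \<subseteq> B \<inter> F" using level_subset[OF F y'(2)] by blast
    then have "card (B \<inter> ?H) \<le> card (B \<inter> F)"
      using min[OF y'(1)] card_mono[of "B \<inter> F" "B \<inter> level (k, y')"] fin by simp
    \<comment> \<open>Passing from \<open>?H\<close> down to \<open>F\<close> loses no vector of
      \<open>B\<close>. So \<open>w\<close>, which lies in \<open>?H\<close> and hence in the span
      of \<open>B \<inter> ?H\<close>, already lies in \<open>F\<close>.\<close>
    then have eq: "B \<inter> F = B \<inter> ?H" using FH fin by (intro card_seteq) auto
    have "(y \<oplus>\<^bsub>U k\<^esub> w) \<ominus>\<^bsub>U k\<^esub> y = w"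
      using yc wc by (simp add: L.add_minus_cancel)
    then have "(k, w) \<in> ?H"
      using gsubspace_minus[OF gsubspace[OF H], of k "y \<oplus>\<^bsub>U k\<^esub> w" y] yw FH mem_level by auto
    then have "(k, w) \<in> gspan (B \<inter> F)" using w B H unfolding eq admissible_def by blast
    then have "(k, w) \<in> F" using gspan_subset[of "B \<inter> F" F] gsubspace[OF F] by blast
    moreover have "(y \<oplus>\<^bsub>U k\<^esub> w) \<ominus>\<^bsub>U k\<^esub> w = y"
      using yc wc by (simp add: L.add_minus_cancel)
    ultimately have "(k, y) \<in> F"
      using gsubspace_minus[OF gsubspace[OF F] yw, of w] by simp
    then show False using \<open>(k, y) \<notin> F\<close> by blast
  qed
  then show ?thesis using that y by blast
qed

text \<open>For a whole coset, the translate found in \<open>F\<close> is itself the competitor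
  \<open>y'\<close> that \<open>optimal_exists\<close> asks for.\<close>

lemma proper_translate_exists:
  assumes B: "admissible B" and v: "v \<in> carrier (U k)"
  obtains w where "(k, w) \<in> gspan B" "proper B k (v \<oplus>\<^bsub>U k\<^esub> w)"
proof -
  have BV: "B \<subseteq> vectors" using B by (auto simp: admissible_def)
  note carr = gsubspace_carrier[OF gsubspace_gspan[OF BV]]
  let ?S = "{v \<oplus>\<^bsub>U k\<^esub> w | w. (k, w) \<in> gspan B}"
  have "?S \<noteq> {}" using gsubspace_zero[OF gsubspace_gspan[OF BV]] by blast
  moreover have "?S \<subseteq> carrier (U k)" using v carr by auto
  ultimately obtain y where y: "y \<in> ?S" and opt:
    "\<And>F w y'. \<lbrakk>F \<in> \<C>; (k, w) \<in> gspan B; (k, y \<oplus>\<^bsub>U k\<^esub> w) \<in> F; y' \<in> ?S; (k, y') \<in> F\<rbrakk> \<Longrightarrow> (k, y) \<in> F"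
    by (rule optimal_exists[OF B]) blast
  obtain w0 where w0: "(k, w0) \<in> gspan B" "y = v \<oplus>\<^bsub>U k\<^esub> w0" using y by auto
  have "y \<oplus>\<^bsub>U k\<^esub> w \<in> ?S" if "(k, w) \<in> gspan B" for w
  proof -
    have "y \<oplus>\<^bsub>U k\<^esub> w = v \<oplus>\<^bsub>U k\<^esub> (w0 \<oplus>\<^bsub>U k\<^esub> w)"
      using w0 v carr that by (simp add: L.a_assoc)
    then show ?thesis using gsubspace_add[OF gsubspace_gspan[OF BV] w0(1) that] by blast
  qed
  then have "proper B k y" unfolding proper_def by (intro ballI allI impI) (rule opt)
  then show ?thesis using that w0 by blast
qed

text \<open>Admissibility writes \<open>p\<close> with vectors of \<open>B \<inter> F\<close> only,
  and none of these is mapped to \<open>q\<close>.\<close>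

lemma shift_avoids:
  assumes B: "admissible B" and F: "F \<in> \<C>"
    and no: "\<And>p. p \<in> B \<inter> F \<Longrightarrow> shift p \<noteq> q" and p: "p \<in> gspan B \<inter> F"
  shows "shift p \<in> gspan (B - {q})"
proof -
  have BV: "B \<subseteq> vectors" and "shift ` B \<subseteq> B \<union> zeros" using B by (auto simp: admissible_def)
  then have "shift ` (B \<inter> F) \<subseteq> (B - {q}) \<union> zeros" using no by blast
  moreover have "p \<in> gspan (B \<inter> F)" using B F p unfolding admissible_def by blast
  ultimately show ?thesis using shift_gspan[of "B \<inter> F" "B - {q}" p] BV by blast
qed

text \<open>By \<open>shift_avoids\<close>, \<open>u k w\<close> has no coordinate at
  \<open>b\<close>, so the sum has coordinate one there. Admissibility then forces \<open>b\<close>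
  itself into \<open>G\<close>.\<close>

lemma mem_image_of_translate:
  assumes B: "admissible B" and F: "F \<in> \<C>" and q: "(\<sigma> k, b) \<in> B"
    and no: "\<And>p. p \<in> B \<inter> F \<Longrightarrow> shift p \<noteq> (\<sigma> k, b)" and w: "(k, w) \<in> gspan B \<inter> F"
    and G: "G \<in> \<C>" and bw: "(\<sigma> k, b \<oplus>\<^bsub>U (\<sigma> k)\<^esub> u k w) \<in> G"
  shows "(\<sigma> k, b) \<in> G"
proof (rule ccontr)
  assume "(\<sigma> k, b) \<notin> G"
  let ?C = "B - {(\<sigma> k, b)}"
  have BV: "B \<subseteq> vectors" and ind: "gindpt B" using B by (auto simp: admissible_def)
  have CV: "?C \<subseteq> vectors" using BV by blast
  have uw: "(\<sigma> k, u k w) \<in> gspan ?C" using shift_avoids[OF B F no w] by simp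
  then have "(\<sigma> k, u k w) \<in> gspan B" using gspan_mono[of ?C B] by blast
  then have "(\<sigma> k, b \<oplus>\<^bsub>U (\<sigma> k)\<^esub> u k w) \<in> gspan B"
    using gsubspace_add[OF gsubspace_gspan[OF BV]] subset_gspan[OF BV] q by blast
  then have "(\<sigma> k, b \<oplus>\<^bsub>U (\<sigma> k)\<^esub> u k w) \<in> gspan (B \<inter> G)"
    using bw B G unfolding admissible_def by blast
  then have "(\<sigma> k, b \<oplus>\<^bsub>U (\<sigma> k)\<^esub> u k w) \<in> gspan ?C"
    using gspan_mono[of "B \<inter> G" ?C] \<open>(\<sigma> k, b) \<notin> G\<close> by blast
  from gsubspace_minus[OF gsubspace_gspan[OF CV] this uw]
  have "(\<sigma> k, (b \<oplus>\<^bsub>U (\<sigma> k)\<^esub> u k w) \<ominus>\<^bsub>U (\<sigma> k)\<^esub> u k w) \<in> gspan ?C" .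
  moreover have "b \<in> carrier (U (\<sigma> k))" "u k w \<in> carrier (U (\<sigma> k))"
    using q BV gsubspace_carrier[OF gsubspace_gspan[OF CV] uw] by auto
  then have "(b \<oplus>\<^bsub>U (\<sigma> k)\<^esub> u k w) \<ominus>\<^bsub>U (\<sigma> k)\<^esub> u k w = b"
    by (simp add: L.add_minus_cancel)
  ultimately show False using gindpt_not_in_gspan[OF BV ind q] by simp
qed

text \<open>If a translate of \<open>y\<close> lies in \<open>G\<close> and \<open>y\<close> does
  not, applying \<open>u k\<close> and \<open>mem_image_of_translate\<close> yields a preimage of
  \<open>b\<close> in \<open>G\<close>. So \<open>opt\<close> need only control such
  \<open>G\<close> inside \<open>F\<close>. It is met either by an optimal preimage or by a
  \<open>b\<close> without preimages in smaller members.\<close>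

lemma admissible_insert_preimage:
  assumes B: "admissible B" and F: "F \<in> \<C>" and q: "(\<sigma> k, b) \<in> B"
    and no: "\<And>p. p \<in> B \<inter> F \<Longrightarrow> shift p \<noteq> (\<sigma> k, b)"
    and y: "(k, y) \<in> F" "u k y = b"
    and opt: "\<And>G w. \<lbrakk>G \<in> \<C>; G \<subseteq> F; (k, w) \<in> gspan B; (k, y \<oplus>\<^bsub>U k\<^esub> w) \<in> G; (\<sigma> k, b) \<in> shift ` G\<rbrakk>
      \<Longrightarrow> (k, y) \<in> G"
  shows "admissible (insert (k, y) B)"
proof (rule admissible_insert[OF B])
  have BV: "B \<subseteq> vectors" and ind: "gindpt B" using B by (auto simp: admissible_def)
  show yc: "y \<in> carrier (U k)" using gsubspace_carrier[OF gsubspace[OF F] y(1)] .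
  \<comment> \<open>Otherwise \<open>b\<close> would be in the span of the other vectors of
    \<open>B\<close>.\<close>
  show "(k, y) \<notin> gspan B"
    using shift_avoids[OF B F no, of "(k, y)"] gindpt_not_in_gspan[OF BV ind q] y by auto
  show "shift (k, y) \<in> B \<union> zeros" using y q by simp
  show "proper B k y"
    unfolding proper_def
  proof (intro ballI allI impI, rule ccontr)
    fix G w assume G: "G \<in> \<C>" and w: "(k, w) \<in> gspan B"
      and yw: "(k, y \<oplus>\<^bsub>U k\<^esub> w) \<in> G" and nG: "(k, y) \<notin> G"
    have wc: "w \<in> carrier (U k)" using gsubspace_carrier[OF gsubspace_gspan[OF BV] w] .
    have GF: "G \<subseteq> F" using total[OF F G] y(1) nG by blast
    have "(y \<oplus>\<^bsub>U k\<^esub> w) \<ominus>\<^bsub>U k\<^esub> y = w"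
      using yc wc by (simp add: L.add_minus_cancel)
    then have wF: "(k, w) \<in> F"
      using gsubspace_minus[OF gsubspace[OF F], of k "y \<oplus>\<^bsub>U k\<^esub> w" y] yw GF y(1) by auto
    have "shift (k, y \<oplus>\<^bsub>U k\<^esub> w) \<in> shift ` G" using yw by blast
    then have "(\<sigma> k, b \<oplus>\<^bsub>U (\<sigma> k)\<^esub> u k w) \<in> shift ` G" using y yc wc by simp
    then have "(\<sigma> k, b) \<in> shift ` G"
      using mem_image_of_translate[OF B F q no _ shift_in[OF G]] w wF by blast
    then show False using opt[OF G GF w yw] nG by blast
  qed
qed

end

subsection \<open>Enlarging admissible sets\<close>

context filtered_rep
begin

text \<open>A preimage already in \<open>B \<inter> F\<close> is reused, so
  \<open>insert p B\<close> may equal \<open>B\<close>. Otherwise an optimal one among the preimages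
  in \<open>F\<close> is adjoined.\<close>

lemma admissible_lift:
  assumes B: "admissible B" and F: "F \<in> \<C>" and q: "q \<in> B" "q \<in> shift ` F"
  obtains p where "p \<in> F" "shift p = q" "admissible (insert p B)"
proof (cases "\<exists>p \<in> B \<inter> F. shift p = q")
  case True
  then obtain p where "p \<in> B" "p \<in> F" "shift p = q" by blast
  then show ?thesis using that B by (metis insert_absorb)
next
  case False
  obtain k x where x: "(k, x) \<in> F" "shift (k, x) = q" using q(2) by auto
  then have q_eq: "q = (\<sigma> k, u k x)" by simp
  let ?S = "{y. (k, y) \<in> F \<and> shift (k, y) = q}"
  have S: "?S \<noteq> {}" using x by blast
  have SU: "?S \<subseteq> carrier (U k)" using gsubspace_carrier[OF gsubspace[OF F]] by blast
  obtain y where y: "y \<in> ?S" and opt: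
    "\<And>G w y'. \<lbrakk>G \<in> \<C>; (k, w) \<in> gspan B; (k, y \<oplus>\<^bsub>U k\<^esub> w) \<in> G; y' \<in> ?S; (k, y') \<in> G\<rbrakk> \<Longrightarrow> (k, y) \<in> G"
    by (rule optimal_exists[OF B S SU]) blast
  have "admissible (insert (k, y) B)"
  proof (rule admissible_insert_preimage[OF B F])
    show "(\<sigma> k, u k x) \<in> B" using q(1) q_eq by simp
    show "shift p \<noteq> (\<sigma> k, u k x)" if "p \<in> B \<inter> F" for p using False that q_eq by blast
    show "(k, y) \<in> F" "u k y = u k x" using y q_eq by auto
    fix G w
    assume G: "G \<in> \<C>" "G \<subseteq> F" "(k, w) \<in> gspan B" "(k, y \<oplus>\<^bsub>U k\<^esub> w) \<in> G"
      and "(\<sigma> k, u k x) \<in> shift ` G"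
    then obtain y' where "(k, y') \<in> G" "u k y' = u k x" by auto
    then show "(k, y) \<in> G" using opt[OF G(1,3,4), of y'] G(2) q_eq by auto
  qed
  then show ?thesis using that y by blast
qed

lemma admissible_lift_set:
  assumes "finite Q" "admissible B" "F \<in> \<C>" "Q \<subseteq> B" "Q \<subseteq> shift ` F"
  obtains N where "N \<subseteq> F" "shift ` N = Q" "admissible (B \<union> N)"
proof -
  have "\<exists>N\<subseteq>F. shift ` N = Q \<and> admissible (B \<union> N)"
    using assms
  proof (induction Q rule: finite_induct)
    case empty
    then show ?case by auto
  next
    case (insert q Q)
    then obtain N where N: "N \<subseteq> F" "shift ` N = Q" "admissible (B \<union> N)" by auto
    obtain p where "p \<in> F" "shift p = q" "admissible (insert p (B \<union> N))"
      using admissible_lift[OF N(3) insert.prems(2), of q] insert.prems by blast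
    then show ?case using N by (intro exI[of _ "insert p N"]) auto
  qed
  then show ?thesis using that by blast
qed

text \<open>Finitely many members of a chain have a largest one. Empty \<open>Q\<close> is separate
  because there may be no member strictly inside \<open>F\<close>.\<close>

lemma common_bound:
  assumes "finite Q" "\<And>q. q \<in> Q \<Longrightarrow> \<exists>G\<in>\<C>. G \<subset> F \<and> q \<in> shift ` G"
  shows "Q = {} \<or> (\<exists>G\<in>\<C>. G \<subset> F \<and> Q \<subseteq> shift ` G)"
  using assms
proof (induction Q rule: finite_induct)
  case (insert q Q)
  then obtain G where G: "G \<in> \<C>" "G \<subset> F" "q \<in> shift ` G" by blast
  consider "Q = {}" | G' where "G' \<in> \<C>" "G' \<subset> F" "Q \<subseteq> shift ` G'"
    using insert by blast
  then show ?case
  proof cases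
    case 1
    then show ?thesis using G by blast
  next
    case 2
    from total[OF G(1) 2(1)] show ?thesis
    proof
      assume "G \<subseteq> G'"
      then have "insert q Q \<subseteq> shift ` G'" using G(3) 2(3) by blast
      then show ?thesis using 2(1,2) by blast
    next
      assume "G' \<subseteq> G"
      then have "insert q Q \<subseteq> shift ` G" using G(3) 2(3) by blast
      then show ?thesis using G(1,2) by blast
    qed
  qed
qed simp

lemma admissible_extend_step:
  assumes B: "admissible B" and v: "v \<in> carrier (U k)" and uv: "shift (k, v) \<in> gspan B"
  obtains B' where "admissible B'" "B \<subseteq> B'" "(k, v) \<in> gspan B'"
proof -
  have BV: "B \<subseteq> vectors" and finB: "finite B" using B by (auto simp: admissible_def)
  have BVN: "B \<union> N \<subseteq> vectors" if "admissible (B \<union> N)" for N using that by (simp add: admissible_def)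
  note sp = gsubspace_gspan[OF BV]
  obtain w0 where w0: "(k, w0) \<in> gspan B" and prp: "proper B k (v \<oplus>\<^bsub>U k\<^esub> w0)"
    using proper_translate_exists[OF B v] .
  have w0c: "w0 \<in> carrier (U k)" using gsubspace_carrier[OF sp w0] .
  define v' where "v' = v \<oplus>\<^bsub>U k\<^esub> w0"
  have v'c: "v' \<in> carrier (U k)" using v w0c by (simp add: v'_def)
  have reduce: "(k, v) \<in> gspan B'" if "B \<subseteq> B'" "B' \<subseteq> vectors" "(k, v') \<in> gspan B'" for B'
  proof -
    have "v' \<ominus>\<^bsub>U k\<^esub> w0 = v" using v w0c by (simp add: v'_def L.add_minus_cancel)
    then show ?thesis
      using gsubspace_minus[OF gsubspace_gspan[OF that(2)] that(3), of w0] gspan_mono[OF that(1)] w0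
      by auto
  qed
  define F where "F = level (k, v')"
  have F: "F \<in> \<C>" using level_in v'c by (simp add: F_def)
  have v'F: "(k, v') \<in> F" by (simp add: F_def mem_level)
  have "(\<sigma> k, u k w0) \<in> gspan B"
    using shift_gspan[OF BV BV _ w0] B by (simp add: admissible_def)
  then have "shift (k, v') \<in> gspan B"
    using gsubspace_add[OF sp] uv v w0c by (simp add: v'_def)
  moreover have "shift (k, v') \<in> shift ` F" using v'F by blast
  ultimately have "shift (k, v') \<in> gspan (B \<inter> shift ` F)"
    using B shift_in[OF F] unfolding admissible_def by blast
  then have ex: "B \<inter> shift ` F \<subseteq> B \<inter> shift ` F \<and> shift (k, v') \<in> gspan (B \<inter> shift ` F)"
    by simp
  obtain R where R: "R \<subseteq> B \<inter> shift ` F" "shift (k, v') \<in> gspan R"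
    and R_min: "\<And>R'. R' \<subseteq> B \<inter> shift ` F \<Longrightarrow> shift (k, v') \<in> gspan R' \<Longrightarrow> card R \<le> card R'"
    using ex_has_least_nat[of "\<lambda>R. R \<subseteq> B \<inter> shift ` F \<and> shift (k, v') \<in> gspan R", OF ex, of card]
    by (elim exE conjE) metis
  have finR: "finite R" using R(1) finB finite_subset by blast
  have RV: "R \<subseteq> vectors" using R(1) BV by blast
  show ?thesis
  \<comment> \<open>The question is whether some \<open>q\<close> in the support has neither a
    preimage in \<open>B \<inter> F\<close> nor one higher than \<open>v'\<close>.\<close>
  proof (cases "\<exists>q\<in>R. (\<forall>p\<in>B \<inter> F. shift p \<noteq> q) \<and> (\<forall>G\<in>\<C>. G \<subset> F \<longrightarrow> q \<notin> shift ` G)")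
    case True
    then obtain q where q: "q \<in> R" and q_no: "\<forall>p\<in>B \<inter> F. shift p \<noteq> q"
      and q_deep: "\<forall>G\<in>\<C>. G \<subset> F \<longrightarrow> q \<notin> shift ` G" by (elim bexE conjE)
    let ?R = "R - {q}"
    have RV': "?R \<subseteq> vectors" using RV by blast
    have nR: "shift (k, v') \<notin> gspan ?R"
      using R_min[of ?R] R(1) q finR by (metis Diff_subset card_Diff1_less leD subset_trans)
    have insR: "insert q ?R = R" using q by blast
    \<comment> \<open>A vector of another degree could be dropped from \<open>R\<close>, against
      minimality.\<close>
    have "fst q = \<sigma> k"
    proof (rule ccontr)
      assume "fst q \<noteq> \<sigma> k"
      then have "\<sigma> k \<noteq> fst q" by simp
      from gspan_insert_other[OF this, of "u k v'" "snd q" ?R] show False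
        using nR R(2) insR by simp
    qed
    then obtain b where qb: "q = (\<sigma> k, b)" by (cases q) simp
    have bc: "b \<in> carrier (U (\<sigma> k))" using q RV qb by auto
    have "(\<sigma> k, u k v') \<in> gspan (insert (\<sigma> k, b) ?R)" using R(2) insR qb by simp
    then obtain c r where c: "c \<in> carrier K" and r: "(\<sigma> k, r) \<in> gspan ?R"
      and ucr: "u k v' = c \<odot>\<^bsub>U (\<sigma> k)\<^esub> b \<oplus>\<^bsub>U (\<sigma> k)\<^esub> r"
      by (rule gspan_insertE[OF RV' bc])
    have rc: "r \<in> carrier (U (\<sigma> k))" using gsubspace_carrier[OF gsubspace_gspan[OF RV'] r] .
    have c0: "c \<noteq> \<zero>\<^bsub>K\<^esub>" using nR r ucr bc rc by auto
    \<comment> \<open>The image of \<open>N\<close> is exactly \<open>?R\<close>, so adjoining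
      \<open>N\<close> creates no preimage of \<open>q\<close>.\<close>
    obtain N where N: "N \<subseteq> F" "shift ` N = ?R" "admissible (B \<union> N)"
      by (rule admissible_lift_set[OF _ B F, of ?R]) (use finR R(1) in blast)+
    have NV: "N \<subseteq> vectors" and BNV: "B \<union> N \<subseteq> vectors" using BVN N(3) by auto
    obtain z where z: "(k, z) \<in> gspan N" and uz: "u k z = r"
      using gspan_shiftE[OF NV] r N(2) by metis
    have zc: "z \<in> carrier (U k)" using gsubspace_carrier[OF gsubspace_gspan[OF NV] z] .
    have zF: "(k, z) \<in> F" using gspan_subset[OF N(1) gsubspace[OF F]] z by blast
    let ?d = "inv\<^bsub>K\<^esub> c"
    have d: "?d \<in> carrier K" using c c0 by blast
    \<comment> \<open>Removing the part over \<open>?R\<close> and dividing by the coefficient turns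
      \<open>v'\<close> into a preimage of \<open>b\<close> in \<open>F\<close>.\<close>
    define y where "y = ?d \<odot>\<^bsub>U k\<^esub> (v' \<ominus>\<^bsub>U k\<^esub> z)"
    have yF: "(k, y) \<in> F"
      unfolding y_def using gsubspace_smult gsubspace_minus gsubspace[OF F] d v'F zF by blast
    have yc: "y \<in> carrier (U k)" using gsubspace_carrier[OF gsubspace[OF F] yF] .
    have "u k (v' \<ominus>\<^bsub>U k\<^esub> z) = c \<odot>\<^bsub>U (\<sigma> k)\<^esub> b"
      using v'c zc uz ucr c bc rc by (simp add: L.add_minus_cancel)
    then have uy: "u k y = b"
      unfolding y_def using L.mult_inverse[OF c bc refl c0] d v'c zc by simp
    have "admissible (insert (k, y) (B \<union> N))"
    proof (rule admissible_insert_preimage[OF N(3) F _ _ yF uy])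
      show "(\<sigma> k, b) \<in> B \<union> N" using q R(1) qb by blast
      show "shift p \<noteq> (\<sigma> k, b)" if p: "p \<in> (B \<union> N) \<inter> F" for p
      proof (cases "p \<in> B")
        case True
        then show ?thesis using q_no p qb by blast
      next
        case False
        then have "shift p \<in> ?R" using p N(2) by blast
        then show ?thesis using qb by blast
      qed
      fix G w assume G: "G \<in> \<C>" "G \<subseteq> F" "(\<sigma> k, b) \<in> shift ` G"
      \<comment> \<open>No member strictly inside \<open>F\<close> contains a preimage of
        \<open>q\<close>, so optimality is trivial.\<close>
      then have "G = F" using q_deep qb by blast
      then show "(k, y) \<in> G" using yF by simp
    qed
    moreover have "(k, v') \<in> gspan (insert (k, y) (B \<union> N))"
    proof -
      let ?B = "insert (k, y) (B \<union> N)"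
      have V: "?B \<subseteq> vectors" using BNV yc by auto
      note sB = gsubspace_gspan[OF V]
      have "c \<odot>\<^bsub>U k\<^esub> y = v' \<ominus>\<^bsub>U k\<^esub> z"
        unfolding y_def using c d c0 v'c zc
        by (simp add: L.smult_inv_cancel)
      moreover have "(k, c \<odot>\<^bsub>U k\<^esub> y) \<in> gspan ?B"
        using gsubspace_smult[OF sB c] subset_gspan[OF V] by blast
      moreover have "(k, z) \<in> gspan ?B" using z gspan_mono[of N ?B] by blast
      ultimately have "(k, (v' \<ominus>\<^bsub>U k\<^esub> z) \<oplus>\<^bsub>U k\<^esub> z) \<in> gspan ?B"
        using gsubspace_add[OF sB] by metis
      moreover have "(v' \<ominus>\<^bsub>U k\<^esub> z) \<oplus>\<^bsub>U k\<^esub> z = v'"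
        using v'c zc by (simp add: a_minus_def L.a_assoc L.l_neg)
      ultimately show ?thesis by simp
    qed
    ultimately show ?thesis
      using that[of "insert (k, y) (B \<union> N)"] reduce[of "insert (k, y) (B \<union> N)"] BNV yc by auto
  next
    case False
    \<comment> \<open>These are the support vectors still lacking a preimage in
      \<open>B \<inter> F\<close>. In this case their new preimages can all be taken in one member
      strictly inside \<open>F\<close>.\<close>
    define Q where "Q = {q \<in> R. \<forall>p\<in>B \<inter> F. shift p \<noteq> q}"
    have finQ: "finite Q" and QR: "Q \<subseteq> R" using finR by (auto simp: Q_def)
    have bound: "Q = {} \<or> (\<exists>G\<in>\<C>. G \<subset> F \<and> Q \<subseteq> shift ` G)"
      by (rule common_bound[OF finQ]) (use False in \<open>auto simp: Q_def\<close>)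
    obtain N where N: "N = {} \<or> (\<exists>G\<in>\<C>. G \<subset> F \<and> N \<subseteq> G)" "shift ` N = Q" "admissible (B \<union> N)"
    proof (cases "Q = {}")
      case True
      then show ?thesis using that[of "{}"] B by simp
    next
      case False
      then obtain G where G: "G \<in> \<C>" "G \<subset> F" "Q \<subseteq> shift ` G" using bound by blast
      have "Q \<subseteq> B" using QR R(1) by blast
      from admissible_lift_set[OF finQ B G(1) this G(3)] show ?thesis using that G by metis
    qed
    have NV: "N \<subseteq> vectors" and BNV: "B \<union> N \<subseteq> vectors" using BVN N(3) by auto
    note sBN = gsubspace_gspan[OF BNV]
    have NF: "N \<subseteq> F" using N(1) by blast
    let ?A = "(B \<inter> F) \<union> N"
    have AV: "?A \<subseteq> vectors" using BNV by blast
    have "R \<subseteq> shift ` ?A" using N(2) unfolding Q_def by blast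
    then have "(\<sigma> k, u k v') \<in> gspan (shift ` ?A)" using subsetD[OF gspan_mono R(2)] by simp
    then obtain z where z: "(k, z) \<in> gspan ?A" and uz: "u k z = u k v'"
      using gspan_shiftE[OF AV] by metis
    have zF: "(k, z) \<in> F" using gspan_subset[of ?A F] gsubspace[OF F] NF z by blast
    have zBN: "(k, z) \<in> gspan (B \<union> N)" using z gspan_mono[of ?A "B \<union> N"] by blast
    have zc: "z \<in> carrier (U k)" using gsubspace_carrier[OF gsubspace[OF F] zF] .
    define s where "s = v' \<ominus>\<^bsub>U k\<^esub> z"
    have sF: "(k, s) \<in> F" unfolding s_def using gsubspace_minus[OF gsubspace[OF F] v'F zF] .
    have sc: "s \<in> carrier (U k)" using gsubspace_carrier[OF gsubspace[OF F] sF] .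
    have v's: "v' = s \<oplus>\<^bsub>U k\<^esub> z"
      unfolding s_def using v'c zc by (simp add: a_minus_def L.a_assoc L.l_neg)
    have us: "u k s = \<zero>\<^bsub>U (\<sigma> k)\<^esub>"
      unfolding s_def using v'c zc uz by (simp add: a_minus_def L.r_neg)
    show ?thesis
    proof (cases "(k, s) \<in> gspan (B \<union> N)")
      case True
      then have "(k, v') \<in> gspan (B \<union> N)" using gsubspace_add[OF sBN _ zBN] v's by simp
      then show ?thesis using that[of "B \<union> N"] N(3) reduce[of "B \<union> N"] BNV by auto
    next
      case False
      \<comment> \<open>A translate of \<open>s\<close> by \<open>w\<close> is the translate of
        \<open>v'\<close> by \<open>w - z\<close>, which splits into parts from
        \<open>gspan B\<close> and \<open>gspan N\<close>. Some \<open>G\<close> strictly inside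
        \<open>F\<close> contains both \<open>G'\<close> and \<open>N\<close>; subtracting the
        second part leaves a translate of \<open>v'\<close> by \<open>gspan B\<close> in
        \<open>G\<close>, against the maximal height of \<open>v'\<close>.\<close>
      have "proper (B \<union> N) k s"
        unfolding proper_def
      proof (intro ballI allI impI, rule ccontr)
        fix G' w
        assume G': "G' \<in> \<C>" and w: "(k, w) \<in> gspan (B \<union> N)"
          and sw: "(k, s \<oplus>\<^bsub>U k\<^esub> w) \<in> G'" and "(k, s) \<notin> G'"
        then have G'F: "G' \<subset> F" using total[OF F G'] sF by blast
        have wc: "w \<in> carrier (U k)" using gsubspace_carrier[OF sBN w] .
        have "(k, w \<ominus>\<^bsub>U k\<^esub> z) \<in> gspan (B \<union> N)" using gsubspace_minus[OF sBN w zBN] .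
        then obtain w1 w2 where w1: "(k, w1) \<in> gspan B" and w2: "(k, w2) \<in> gspan N"
          and w12: "w \<ominus>\<^bsub>U k\<^esub> z = w1 \<oplus>\<^bsub>U k\<^esub> w2"
          using gspan_UnE[OF BV NV] by blast
        have w1c: "w1 \<in> carrier (U k)" and w2c: "w2 \<in> carrier (U k)"
          using gsubspace_carrier[OF sp w1] gsubspace_carrier[OF gsubspace_gspan[OF NV] w2] by auto
        obtain G where G: "G \<in> \<C>" "G \<subset> F" "G' \<subseteq> G" "N \<subseteq> G"
        proof (cases "N = {}")
          case True
          then show ?thesis using that[of G'] G' G'F by blast
        next
          case False
          then obtain G where G: "G \<in> \<C>" "G \<subset> F" "N \<subseteq> G" using N(1) by blast
          from total[OF G(1) G'] show ?thesis
          proof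
            assume "G \<subseteq> G'"
            then show ?thesis using that[of G'] G' G'F G(3) by blast
          next
            assume "G' \<subseteq> G"
            then show ?thesis using that[of G] G by blast
          qed
        qed
        have "s \<oplus>\<^bsub>U k\<^esub> w = v' \<oplus>\<^bsub>U k\<^esub> (w \<ominus>\<^bsub>U k\<^esub> z)"
          unfolding s_def using v'c zc wc by (simp add: a_minus_def L.a_ac)
        also have "\<dots> = (v' \<oplus>\<^bsub>U k\<^esub> w1) \<oplus>\<^bsub>U k\<^esub> w2"
          unfolding w12 using v'c w1c w2c by (simp add: L.a_assoc)
        finally have "(s \<oplus>\<^bsub>U k\<^esub> w) \<ominus>\<^bsub>U k\<^esub> w2 = v' \<oplus>\<^bsub>U k\<^esub> w1"
          using v'c w1c w2c by (simp add: L.add_minus_cancel)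
        moreover have "(k, w2) \<in> G" using gspan_subset[OF G(4) gsubspace[OF G(1)]] w2 by blast
        ultimately have "(k, v' \<oplus>\<^bsub>U k\<^esub> w1) \<in> G"
          using gsubspace_minus[OF gsubspace[OF G(1)], of k "s \<oplus>\<^bsub>U k\<^esub> w" w2] sw G(3) by auto
        then have "(k, v') \<in> G" using prp w1 G(1) unfolding proper_def v'_def by blast
        then have "F \<subseteq> G" unfolding F_def using level_subset[OF G(1)] by blast
        then show False using G(2) by blast
      qed
      then have adm: "admissible (insert (k, s) (B \<union> N))"
        using admissible_insert[OF N(3) sc False] us by simp
      let ?B = "insert (k, s) (B \<union> N)"
      have V: "?B \<subseteq> vectors" using BNV sc by auto
      have "(k, s) \<in> gspan ?B" "(k, z) \<in> gspan ?B"
        using subset_gspan[OF V] zBN gspan_mono[of "B \<union> N" ?B] by auto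
      then have "(k, v') \<in> gspan ?B" using gsubspace_add[OF gsubspace_gspan[OF V]] v's by simp
      then show ?thesis using that[OF adm] reduce[of ?B] V by auto
    qed
  qed
qed

section \<open>Local nilpotency and exhaustion in countable dimension\<close>

lemma admissible_extend:
  assumes "admissible B" "p \<in> vectors" "(shift ^^ i) p \<in> zeros"
  shows "\<exists>B'. admissible B' \<and> B \<subseteq> B' \<and> p \<in> gspan B'"
  using assms(2,3)
proof (induction i arbitrary: p)
  case 0
  have "B \<subseteq> vectors" using assms(1) by (simp add: admissible_def)
  then have "p \<in> gspan B" using 0 gsubspace_zero gsubspace_gspan by (cases p) auto
  then show ?case using assms(1) by blast
next
  case (Suc i)
  obtain k v where p: "p = (k, v)" "v \<in> carrier (U k)" using Suc.prems by (cases p) auto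
  \<comment> \<open>The image of \<open>p\<close> reaches zero one step earlier, so the induction
    absorbs it before \<open>p\<close>.\<close>
  obtain B1 where B1: "admissible B1" "B \<subseteq> B1" "shift p \<in> gspan B1"
    using Suc.IH[of "shift p"] Suc.prems shift_vectors by (auto simp: funpow_Suc_right simp del: funpow.simps)
  obtain B2 where "admissible B2" "B1 \<subseteq> B2" "p \<in> gspan B2"
    using admissible_extend_step[of B1 v k] B1 p by metis
  then show ?case using B1 by blast
qed

lemma adapted_family_exists:
  assumes D: "countable D" "D \<subseteq> vectors" "gspan D = vectors"
    and nil: "\<And>p. p \<in> D \<Longrightarrow> \<exists>i. (shift ^^ i) p \<in> zeros"
  shows "\<exists>B\<subseteq>vectors. gindpt B \<and> gspan B = vectors \<and> shift ` B \<subseteq> B \<union> zeros"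
proof (cases "D = {}")
  case True
  then show ?thesis using D admissible_empty by (auto simp: admissible_def)
next
  case False
  \<comment> \<open>The enumeration repeats vectors when \<open>D\<close> is finite; absorbing a
    vector again is harmless.\<close>
  define e where "e = from_nat_into D"
  have range_e: "range e = D" using D(1) False by (simp add: e_def range_from_nat_into)
  have step: "\<exists>B'. admissible B' \<and> B \<subseteq> B' \<and> e i \<in> gspan B'" if "admissible B" for B i
    using admissible_extend[OF that, of "e i"] nil[of "e i"] D(2) range_e by blast
  define next_set where "next_set i B = (SOME B'. admissible B' \<and> B \<subseteq> B' \<and> e i \<in> gspan B')" for i B
  define S where "S = rec_nat {} next_set"
  have S0: "S 0 = {}" and SSuc: "S (Suc i) = next_set i (S i)" for i by (simp_all add: S_def)
  have next_set: "admissible (next_set i B) \<and> B \<subseteq> next_set i B \<and> e i \<in> gspan (next_set i B)"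
    if "admissible B" for i B
    unfolding next_set_def by (rule someI_ex[OF step[OF that]])
  have adm: "admissible (S i)" for i
    by (induction i) (simp_all add: S0 SSuc admissible_empty next_set)
  have mono: "i \<le> j \<Longrightarrow> S i \<subseteq> S j" for i j
    by (rule lift_Suc_mono_le[of S]) (use next_set[OF adm] in \<open>auto simp: SSuc\<close>)
  let ?B = "\<Union>i. S i"
  have BV: "?B \<subseteq> vectors" using adm unfolding admissible_def by blast
  have "D \<subseteq> gspan ?B"
  proof
    fix p assume "p \<in> D"
    then obtain i where "p = e i" using range_e by blast
    then have "p \<in> gspan (S (Suc i))" using next_set[OF adm[of i], of i] by (simp add: SSuc)
    then show "p \<in> gspan ?B" using gspan_mono[of "S (Suc i)" ?B] by blast
  qed
  then have "gspan ?B = vectors"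
    using gspan_subset[OF _ gsubspace_gspan[OF BV], of D] D(3) gsubspace_subset[OF gsubspace_gspan[OF BV]]
    by blast
  moreover have "shift ` ?B \<subseteq> ?B \<union> zeros"
    using adm unfolding admissible_def by blast
  moreover have "gindpt ?B"
    unfolding gindpt_def
  proof
    fix k
    have eq: "?B `` {k} = \<Union>(range (\<lambda>i. S i `` {k}))" by blast
    have chain: "subset.chain UNIV (range (\<lambda>i. S i `` {k}))"
      unfolding subset_chain_def
    proof (intro conjI subset_UNIV ballI)
      fix X Y assume "X \<in> range (\<lambda>i. S i `` {k})" "Y \<in> range (\<lambda>i. S i `` {k})"
      then obtain i j where XY: "X = S i `` {k}" "Y = S j `` {k}" by blast
      from nle_le mono have "S i \<subseteq> S j \<or> S j \<subseteq> S i" by metis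
      then show "X \<subseteq> Y \<or> Y \<subseteq> X" unfolding XY by blast
    qed
    have "module.lin_indpt K (U k) A" if "A \<in> range (\<lambda>i. S i `` {k})" for A
      using that adm unfolding admissible_def gindpt_def by blast
    from L.lin_indpt_Union_chain[OF chain _ this]
    show "module.lin_indpt K (U k) (?B `` {k})" unfolding eq by blast
  qed
  ultimately show ?thesis using BV by blast
qed

end

subsection \<open>Cyclic quivers\<close>

text \<open>Fixing the indices from \<open>n\<close> on makes this a bijection of the whole type, as
  \<open>graded_rep\<close> demands.\<close>

definition cyclic_succ :: "nat \<Rightarrow> nat \<Rightarrow> nat"
  where "cyclic_succ n k = (if k < n then (k + 1) mod n else k)"

lemma bij_cyclic_succ: "bij (cyclic_succ n)"
proof (rule bijI')
  fix j k
  have "j = k" if "(j + 1) mod n = (k + 1) mod n" "j < n" "k < n"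
    using that by (simp add: mod_Suc split: if_splits)
  moreover have "(k + 1) mod n < n" if "k < n" for k using that by simp
  ultimately show "cyclic_succ n j = cyclic_succ n k \<longleftrightarrow> j = k"
    unfolding cyclic_succ_def by (smt (verit))
next
  fix k
  consider "k \<ge> n" | "k = 0" "n > 0" | m where "k = Suc m" "k < n" by (cases k) force+
  then show "\<exists>j. k = cyclic_succ n j"
  proof cases
    case 1
    then show ?thesis by (intro exI[of _ k]) (simp add: cyclic_succ_def)
  next
    case 2
    then show ?thesis by (intro exI[of _ "n - 1"]) (simp add: cyclic_succ_def)
  next
    case 3
    then show ?thesis by (intro exI[of _ m]) (simp add: cyclic_succ_def)
  qed
qed

lemma (in vectorspace) linear_map_zero:
  assumes "vectorspace K W"
  shows "linear_map K V W (\<lambda>_. \<zero>\<^bsub>W\<^esub>)"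
proof -
  interpret W: vectorspace K W by fact
  show ?thesis by unfold_locales (simp add: module_hom_def)
qed

theorem theorem1p10:
  fixes K :: "('f, 'c) ring_scheme"
    and n :: nat
    and U :: "nat \<Rightarrow> ('f, 'v, 'd) module_scheme"
    and u :: "nat \<Rightarrow> 'v \<Rightarrow> 'v"
  assumes "field K"
    and "n > 0"
    and "cyclic_rep K n U u"
    and "locally_nilpotent n U u"
    and "countable_dimension K n U"
  shows "\<exists>B. adapted_basis K n U u B"
proof -
  \<comment> \<open>Beyond the indices \<open>k < n\<close> the representation is padded by copies of \<open>U 0\<close> with zero maps, so
    that the successor becomes a bijection of the whole index type.\<close>
  define U' where "U' k = (if k < n then U k else U 0)" for k
  define u' where "u' k = (if k < n then u k else (\<lambda>_. \<zero>\<^bsub>U 0\<^esub>))" for k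
  have vs: "vectorspace K (U k)" and lin: "linear_map K (U k) (U ((k + 1) mod n)) (u k)" if "k < n" for k
    using assms(3) that by (auto simp: cyclic_rep_def)
  have "linear_map K (U' k) (U' (cyclic_succ n k)) (u' k)" for k
  proof (cases "k < n")
    case True
    then show ?thesis using lin \<open>n > 0\<close> by (simp add: U'_def u'_def cyclic_succ_def)
  next
    case False
    then show ?thesis
      using vectorspace.linear_map_zero[OF vs vs, OF \<open>n > 0\<close> \<open>n > 0\<close>]
      by (simp add: U'_def u'_def cyclic_succ_def)
  qed
  then interpret graded_rep K U' "cyclic_succ n" u'
    by (rule graded_rep.intro) (rule bij_cyclic_succ)
  obtain \<C> where "filtered_rep K U' (cyclic_succ n) u' \<C>" using filtration_exists by blast
  then interpret filtered_rep K U' "cyclic_succ n" u' \<C> .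
  have shift_pow: "(shift ^^ i) (k, x) = ((k + i) mod n, path_map n u k i x)" if "k < n" for i k x
    using that by (induction i) (simp_all add: cyclic_succ_def u'_def mod_simps)
  have zeros_shift: "p \<in> zeros \<Longrightarrow> (shift ^^ i) p \<in> zeros" for i p
    by (induction i) (auto simp: zeros_def)
  have pow_vectors: "p \<in> vectors \<Longrightarrow> (shift ^^ i) p \<in> vectors" for i p
    by (induction i) (auto simp: shift_vectors)
  have cycle: "((shift ^^ n) ^^ i) (0, x) = (0, (cycle_map n u 0 ^^ i) x)" for i x
    by (induction i) (use \<open>n > 0\<close> in \<open>simp_all add: shift_pow cycle_map_def\<close>)
  have nil: "\<exists>i. (shift ^^ i) p \<in> zeros" if p: "p \<in> vectors" for p
  proof -
    obtain k x where kx: "p = (k, x)" by (cases p)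
    show ?thesis
    proof (cases "k < n")
      case True
      \<comment> \<open>After \<open>n - k\<close> steps (a full turn if \<open>k = 0\<close>) the
        vector sits at vertex 0, where nilpotency is assumed.\<close>
      obtain y where y: "(shift ^^ (n - k)) p = (0, y)" using shift_pow[OF True] True kx by simp
      have "(0, y) \<in> vectors" using pow_vectors[OF p] y by metis
      then have "y \<in> carrier (U 0)" using \<open>n > 0\<close> by (simp add: U'_def)
      then obtain i where "(cycle_map n u 0 ^^ i) y = \<zero>\<^bsub>U 0\<^esub>"
        using assms(4) unfolding locally_nilpotent_def by blast
      then have "((shift ^^ n) ^^ i) ((shift ^^ (n - k)) p) \<in> zeros"
        using y cycle \<open>n > 0\<close> by (simp add: U'_def)
      then have "(shift ^^ (n * i + (n - k))) p \<in> zeros"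
        by (simp add: funpow_add funpow_mult)
      then show ?thesis by blast
    next
      case False
      then have "(shift ^^ 1) p \<in> zeros" using kx by (simp add: U'_def u'_def cyclic_succ_def)
      then show ?thesis by blast
    qed
  qed
  obtain D where D: "\<And>k. k < n \<Longrightarrow> vectorspace.basis K (U k) (D k)"
    and count: "countable (SIGMA k:{..<n}. D k)"
    using assms(5) unfolding countable_dimension_def by blast
  have Dcount: "countable (D k)" if "k < n" for k
  proof -
    have "D k \<subseteq> snd ` (SIGMA k:{..<n}. D k)" using that by force
    then show ?thesis using count countable_subset by blast
  qed
  \<comment> \<open>The padding copies of \<open>U 0\<close> receive the basis \<open>D 0\<close>,
    so \<open>D'\<close> spans every degree and stays countable.\<close>
  define D' where "D' = (SIGMA k:UNIV. if k < n then D k else D 0)"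
  have slice: "D' `` {k} = (if k < n then D k else D 0)" for k by (auto simp: D'_def)
  have basis: "vectorspace.basis K (U' k) (D' `` {k})" for k
    using D \<open>n > 0\<close> by (simp add: slice U'_def)
  have "countable D'" unfolding D'_def using Dcount \<open>n > 0\<close> by (intro countable_SIGMA) auto
  moreover have "D' \<subseteq> vectors"
    using basis by (fastforce simp: L.basis_def)
  moreover have "gspan D' = vectors"
    using basis by (auto simp: L.basis_def gspan_def vectors_def)
  ultimately obtain B where B: "B \<subseteq> vectors" "gindpt B" "gspan B = vectors" "shift ` B \<subseteq> B \<union> zeros"
    using adapted_family_exists[of D'] nil by blast
  have "adapted_basis K n U u (\<lambda>k. B `` {k})"
    unfolding adapted_basis_def
  proof (intro allI impI conjI ballI)
    fix k assume k: "k < n"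
    have "module.span K (U' k) (B `` {k}) = carrier (U' k)"
      using B(3) gspan_iff[of k _ B] by auto
    then have "vectorspace.basis K (U' k) (B `` {k})"
      using B(2) slice_vectors[OF B(1)] by (simp add: L.basis_def gindpt_def)
    then show "vectorspace.basis K (U k) (B `` {k})" using k by (simp add: U'_def)
    fix x assume "x \<in> B `` {k}"
    then have "shift (k, x) \<in> B \<union> zeros" using B(4) by blast
    then show "u k x \<in> B `` {(k + 1) mod n} \<or> u k x = \<zero>\<^bsub>U ((k + 1) mod n)\<^esub>"
      using k \<open>n > 0\<close> by (auto simp: cyclic_succ_def u'_def U'_def)
  qed
  then show ?thesis by blast
qed

end
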